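(* Let $n\ge 1$. For each $i=1,\dots,n$ let $A^{(i)}=\{\omega^{(i)},\sigma^{(i)},\bar 0\}\subset\mathbb{Z}^n_{\geqslant}$ be a three-element set of exponent vectors containing the zero vector $\bar 0$. In each $A^{(i)}$ fix an ordered pair of distinct elements $\mu^{(i)},\nu^{(i)}$, and let $\beta^{(i)}$ denote the remaining (third) element of $A^{(i)}$. Let $\varkappa$ be the $n\times n$ matrix with columns $\mu^{(1)}-\nu^{(1)},\dots,\mu^{(n)}-\nu^{(n)}$, and assume $\varkappa$ is nondegenerate. Let $\overline{\beta}$ be the $n\times n$ matrix with columns $\beta^{(i)}-\nu^{(i)}$, $i=1,\dots,n$. Consider the reduced trinomial system $$ r^{(i)}_{\beta^{(i)}}\, y^{\beta^{(i)}} + y^{\mu^{(i)}} - y^{\nu^{(i)}} = 0,\qquad i=1,\dots,n,$$ with unknown $y=(y_1,\dots,y_n)$ and complex variable coefficients $r=(r^{(1)}_{\beta^{(1)}},\dots,r^{(n)}_{\beta^{(n)}})\in\mathbb{C}^n$ (written $r=(r_1,\dots,r_n)$). Let $y(r)$ be its principal solution, i.e. the branch of the algebraic solution with $y_i(0)=1$ for all $i$, and for $d=(d_1,\dots,d_n)\in\mathbb{R}^n_+$ let $y^d(r)=y_1^{d_1}(r)\cdots y_n^{d_n}(r)$. Then, in a neighbourhood of the origin, $y^d(r)$ admits the Taylor series representation $$ y^d(r)=\sum_{k\in\mathbb{Z}^n_{\geqslant}} c_k\, r^k,\qquad r^k=r_1^{k_1}\cdots r_n^{k_n},$$ with coefficients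 $$ c_k=\frac{(-1)^{|k|}}{k!}\,\frac{\Gamma\left(\varkappa^{-1}d+\varkappa^{-1}\overline{\beta}k\right)}{\Gamma\left(\varkappa^{-1}d+\varkappa^{-1}\overline{\beta}k-k+I\right)}\,Q(k),\qquad k\in\mathbb{Z}^n_{\geqslant},$$ where $Q(k)=\det\left(\operatorname{diag}\left[\varkappa^{-1}d+\varkappa^{-1}\overline{\beta}k\right]-\varkappa^{-1}\overline{\beta}\,\operatorname{diag}[k]\right)$.
   Context: $y^\alpha=y_1^{\alpha_1}\cdots y_n^{\alpha_n}$; $\mathbb{Z}^n_{\geqslant}$ denotes vectors with nonnegative integer entries. Powers $y_j^{d_j}$ near $y_j=1$ are taken with the principal branch (equal to $1$ at $y_j=1$). For a vector $b=(b_1,\dots,b_n)$, $\Gamma(b)$ denotes $\prod_{k=1}^n\Gamma(b_k)$, and $\operatorname{diag}[b]$ is the diagonal matrix with $b_1,\dots,b_n$ on the diagonal. $I=(1,\dots,1)$, $k!=k_1!\cdots k_n!$, $|k|=k_1+\dots+k_n$. A ratio of products of Gamma functions is understood as the meromorphic function obtained after removing removable singularities (e.g. $\Gamma(-1)/\Gamma(0)=-1$), so it has a finite value when the arguments hit nonpositive integers.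
   Formalization: Where k_j=0 and the j-th entry of ϰ^{-1}d+ϰ^{-1}β̄k is 0, the Gamma ratio in c_k has a true pole and Q(k)=0; there c_k is taken as the limiting value of the product of ratio and Q(k) (the factor Γ(a_j)/Γ(a_j+1) cancelled against column j of the determinant). *)

theory Defs
  imports "HOL-Analysis.Analysis"
begin

definition monomial :: "complex^'n \<Rightarrow> nat^'n \<Rightarrow> complex" where
  "monomial y \<alpha> = (\<Prod>j\<in>UNIV. (y $ j) ^ (\<alpha> $ j))"

definition real_power_vec :: "complex^'n \<Rightarrow> real^'n \<Rightarrow> complex" where
  "real_power_vec y d = (\<Prod>j\<in>UNIV. (y $ j) powr (complex_of_real (d $ j)))"

definition diag_mat :: "real^'n \<Rightarrow> real^'n^'n" where
  "diag_mat b = (\<chi> i j. if i = j then b $ i else 0)"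

definition of_nat_vec :: "nat^'n \<Rightarrow> real^'n" where
  "of_nat_vec k = (\<chi> j. real (k $ j))"

definition kappa_mat :: "('n \<Rightarrow> nat^'n) \<Rightarrow> ('n \<Rightarrow> nat^'n) \<Rightarrow> real^'n^'n" where
  "kappa_mat \<mu> \<nu> = (\<chi> row col. real (\<mu> col $ row) - real (\<nu> col $ row))"

text \<open>The ratio Gamma(a)/Gamma(b), understood as a meromorphic function with
  removable singularities removed: when a - b is an integer it is a
  (reciprocal) Pochhammer symbol.\<close>
definition gamma_ratio :: "real \<Rightarrow> real \<Rightarrow> real" where
  "gamma_ratio a b =
     (if a - b \<in> \<int> then
        (if b \<le> a then pochhammer b (nat \<lfloor>a - b\<rfloor>)
         else 1 / pochhammer a (nat \<lfloor>b - a\<rfloor>))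
      else Gamma a / Gamma b)"

definition arg_vec :: "real^'n^'n \<Rightarrow> real^'n^'n \<Rightarrow> real^'n \<Rightarrow> nat^'n \<Rightarrow> real^'n" where
  "arg_vec K Bb d k = matrix_inv K *v d + (matrix_inv K ** Bb) *v of_nat_vec k"

definition Q_det :: "real^'n^'n \<Rightarrow> real^'n^'n \<Rightarrow> real^'n \<Rightarrow> nat^'n \<Rightarrow> real" where
  "Q_det K Bb d k = det (diag_mat (arg_vec K Bb d k) - (matrix_inv K ** Bb) ** diag_mat (of_nat_vec k))"

text \<open>The coefficient c_k = (-1)^|k|/k! * Gamma(a)/Gamma(a-k+I) * Q(k), with
  a = arg_vec.  The product of Gamma ratios is absorbed columnwise into the
  determinant Q(k): column j of the matrix is multiplied by
  Gamma(a_j)/Gamma(a_j-k_j+1).  For k_j >= 1 this factor is a polynomial in a_j.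
  For k_j = 0 the factor is 1/a_j and column j of the matrix equals a_j e_j, so the
  scaled column is e_j; this is the removal of the (removable) singularity at
  a_j = 0, and coincides with the literal formula whenever a_j \<noteq> 0.\<close>
definition coeff :: "real^'n^'n \<Rightarrow> real^'n^'n \<Rightarrow> real^'n \<Rightarrow> nat^'n \<Rightarrow> real" where
  "coeff K Bb d k =
     (let a = arg_vec K Bb d k;
          M = diag_mat a - (matrix_inv K ** Bb) ** diag_mat (of_nat_vec k)
      in ((-1) ^ (\<Sum>j\<in>UNIV. k $ j) / (\<Prod>j\<in>UNIV. fact (k $ j))) *
         det (\<chi> i j. if k $ j = 0 then (if i = j then 1 else 0)
                      else M $ i $ j * gamma_ratio (a $ j) (a $ j - real (k $ j) + 1)))"

end

theory Submission
  imports "HOL-Complex_Analysis.Complex_Analysis" Defs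
begin

text \<open>
  Put $P = \varkappa^{-1}\overline\beta$, $c = \varkappa^{-1}d$ and
  $u_i = \log y^{\mu^{(i)} - \nu^{(i)}}$.  The system becomes
  $e^{u_i} + r_i e^{\sum_l P_{li} u_l} = 1$, and $y^d = e^{c \cdot u}$.  Replacing $r$ by $t r$
  and iterating a contraction gives a solution $v(t)$ that is holomorphic for $|t| < 2$, with
  $v(0) = 0$ and $v(1) = u$.  Let $g_m(c)$ be the coefficient of $t^m$ in $e^{c \cdot v(t)}$.
  Multiplying the $i$-th equation by $e^{c \cdot v}$ gives
  $g_m(c) = g_m(c + e_i) + r_i\, g_{m-1}(c + P e_i)$.

  Written as a determinant of binomial coefficients, the claimed coefficients satisfy the same
  recurrence, by Pascal's rule in one row.  Both families are polynomial in $c$ along coordinate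
  lines, and both vanish at $c = 0$ for $m > 0$.  By induction on $m$ their difference is a
  polynomial with period $e_i$ for every $i$, hence constant, hence zero.  An exponential bound on
  the coefficients gives unconditional summability, and $t = 1$ gives the theorem.
\<close>

(* Formal power series and vectors share this infix. *)
no_notation fps_nth (infixl \<open>$\<close> 75)

section \<open>Good's coefficients\<close>

text \<open>
  The coefficient of $x^k$ in $\delta (1-x)^a + p x (1-x)^{a-1}$.  With $a = c + Pk$, Good's
  formula for the system $x_i = r_i \prod_j (1-x_j)^{P_{ji}}$ is the coefficient of $x^k$ in
  $\prod_j (1-x_j)^{a_j} \cdot \det (\delta_{ij} + P_{ij} x_j / (1-x_j))$.  Row $j$ of the
  transposed matrix, multiplied by $(1-x_j)^{a_j}$, involves $x_j$ only, so coefficients may be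
  extracted row by row.
\<close>

definition trinomial_entry :: "real \<Rightarrow> real \<Rightarrow> real \<Rightarrow> nat \<Rightarrow> real" where
  "trinomial_entry \<delta> p a k =
     (-1) ^ k * (\<delta> * (a gchoose k) - p * (if k = 0 then 0 else (a - 1) gchoose (k - 1)))"

definition good_det :: "real^'n^'n \<Rightarrow> real^'n \<Rightarrow> nat^'n \<Rightarrow> real" where
  "good_det P a k = det (\<chi> j i. trinomial_entry (of_bool (i = j)) (P $ i $ j) (a $ j) (k $ j))"

definition good_coeff :: "real^'n^'n \<Rightarrow> real^'n \<Rightarrow> nat^'n \<Rightarrow> real" where
  "good_coeff P c k = good_det P (c + P *v of_nat_vec k) k"

section \<open>Recurrences and values of Good's coefficients\<close>

lemma trinomial_entry_0 [simp]: "trinomial_entry \<delta> p a 0 = \<delta>"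
  by (simp add: trinomial_entry_def)

text \<open>Raising a by 1 multiplies the generating function by 1 - x; this is the comparison of
  coefficients of x^(k+1).\<close>

lemma trinomial_entry_pascal:
  "trinomial_entry \<delta> p a (Suc k) = trinomial_entry \<delta> p (a + 1) (Suc k) + trinomial_entry \<delta> p a k"
proof -
  have 1: "(a + 1) gchoose Suc k = (a gchoose k) + (a gchoose Suc k)"
    by (rule gbinomial_Suc_Suc)
  have 2: "a gchoose k = ((a - 1) gchoose k) + (if k = 0 then 0 else (a - 1) gchoose (k - 1))"
  proof (cases k)
    case (Suc m)
    then show ?thesis using gbinomial_Suc_Suc[of "a - 1" m] by simp
  qed simp
  define q where "q = (if k = 0 then 0 else (a - 1) gchoose (k - 1))"
  show ?thesis
    unfolding trinomial_entry_def q_def[symmetric]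
    by (simp add: 1 2[folded q_def] ring_distribs)
qed

text \<open>Absorption, (a choose k+1) = a/(k+1) (a-1 choose k), gives both terms the same binomial.
  What remains is, up to transposition, an entry of the matrix in Q(k).\<close>

lemma trinomial_entry_Suc:
  "trinomial_entry \<delta> p a (Suc k) =
     (-1) ^ Suc k * ((a - 1) gchoose k) / real (Suc k) * (a * \<delta> - p * real (Suc k))"
proof -
  have "real (Suc k) * (a gchoose Suc k) = a * ((a - 1) gchoose k)"
    using gbinomial_absorption[of k a] by (simp add: gbinomial_absorption)
  hence "a gchoose Suc k = a * ((a - 1) gchoose k) / real (Suc k)"
    by (simp add: field_simps)
  thus ?thesis unfolding trinomial_entry_def by (simp add: right_diff_distrib del: of_nat_Suc)
qed

text \<open>Row l is the only row containing a_l or k_l, so linearity of the determinant in that row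
  lifts Pascal's rule to the whole determinant.\<close>

lemma good_det_decompose:
  fixes P :: "real^'n^'n"
  assumes "k $ l > 0" and "\<And>j. j \<noteq> l \<Longrightarrow> k' $ j = k $ j" and "k' $ l = k $ l - 1"
  shows "good_det P a k = good_det P (a + axis l 1) k + good_det P a k'"
proof -
  define f where "f a k j = (\<chi> i. trinomial_entry (of_bool (i = j)) (P $ i $ j) (a $ j) (k $ j))"
    for a and k :: "nat^'n" and j
  have D: "good_det P a k = det (\<chi> j. f a k j)" for a k
    unfolding good_det_def f_def by simp
  obtain m where m: "k $ l = Suc m" using assms(1) gr0_implies_Suc by blast
  have "f a k l = f (a + axis l 1) k l + f a k' l"
    using m assms(3) trinomial_entry_pascal[of _ _ "a $ l" m]
    by (simp add: f_def vec_eq_iff)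
  hence 1: "(\<chi> j. f a k j) = (\<chi> j. if j = l then f (a + axis l 1) k j + f a k' j else f a k j)"
    by (simp add: vec_eq_iff)
  have 2: "(\<chi> j. f (a + axis l 1) k j) = (\<chi> j. if j = l then f (a + axis l 1) k j else f a k j)"
    by (simp add: vec_eq_iff f_def axis_def)
  have 3: "(\<chi> j. f a k' j) = (\<chi> j. if j = l then f a k' j else f a k j)"
    using assms(2) by (simp add: vec_eq_iff f_def)
  show ?thesis
    unfolding D by (subst 1, subst 2, subst 3) (rule det_row_add)
qed

lemma of_nat_vec_diff_axis:
  assumes "k $ l > 0"
  shows "of_nat_vec (k - axis l 1) = of_nat_vec k - axis l 1"
  using assms by (auto simp: of_nat_vec_def vec_eq_iff axis_def)

text \<open>Lowering k by e_l lowers Pk by column l of P. Adding that column to c therefore leaves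
  the argument a = c + Pk fixed, as \<open>good_det_decompose\<close> requires.\<close>

lemma good_coeff_rec:
  assumes "k $ l > 0"
  shows "good_coeff P c k = good_coeff P (c + axis l 1) k + good_coeff P (c + column l P) (k - axis l 1)"
proof -
  have "P *v axis l 1 = column l P"
    by (simp add: matrix_vector_mul_component vec_eq_iff column_def axis_def matrix_vector_mult_def if_distrib cong: if_cong)
  hence 1: "c + column l P + P *v of_nat_vec (k - axis l 1) = c + P *v of_nat_vec k"
    by (simp add: of_nat_vec_diff_axis[OF assms] matrix_vector_mult_diff_distrib del: One_nat_def)
  have 2: "c + axis l 1 + P *v of_nat_vec k = c + P *v of_nat_vec k + axis l 1"
    by (simp add: add_ac)
  show ?thesis
    unfolding good_coeff_def 1 2
    by (rule good_det_decompose) (use assms in \<open>auto simp: axis_def\<close>)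
qed

text \<open>For k_l = 0, row l is a unit vector whatever a_l is. This is the boundary case of
  \<open>good_coeff_rec\<close>, in which the second summand is absent.\<close>

lemma good_coeff_shift:
  fixes P :: "real^'n^'n"
  assumes "k $ l = 0"
  shows "good_coeff P (c + axis l 1) k = good_coeff P c k"
proof -
  have *: "trinomial_entry \<delta> p ((c + axis l 1 + P *v of_nat_vec k) $ j) (k $ j)
      = trinomial_entry \<delta> p ((c + P *v of_nat_vec k) $ j) (k $ j)" for \<delta> p j
    using assms by (cases "j = l") (auto simp: axis_def)
  show ?thesis unfolding good_coeff_def good_det_def * ..
qed

lemma good_coeff_k0 [simp]:
  fixes P :: "real^'n^'n"
  shows "good_coeff P c 0 = 1"
proof -
  have "(\<chi> j i. of_bool (i = j)) = (mat 1 :: real^'n^'n)"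
    by (auto simp: mat_def vec_eq_iff)
  thus ?thesis by (simp add: good_coeff_def good_det_def)
qed

text \<open>By \<open>trinomial_entry_Suc\<close> each row with k_j > 0 is a scalar times a row of
  the transposed matrix of Q(k). Rows with k_j = 0 are already unit vectors and get the scalar
  1.\<close>

lemma good_det_factor:
  fixes P :: "real^'n^'n"
  shows "good_det P a k =
    (\<Prod>j\<in>UNIV. if k $ j = 0 then 1 else (-1) ^ (k $ j) * ((a $ j - 1) gchoose (k $ j - 1)) / real (k $ j)) *
    det (\<chi> j i. if k $ j = 0 then of_bool (i = j)
                else a $ j * of_bool (i = j) - P $ i $ j * real (k $ j))"
    (is "_ = prod ?s _ * det ?M")
proof -
  have "trinomial_entry (of_bool (i = j)) (P $ i $ j) (a $ j) (k $ j) = ?s j * ?M $ j $ i" for i j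
    by (cases "k $ j") (simp_all only: trinomial_entry_Suc, simp_all)
  hence "(\<chi> j i. trinomial_entry (of_bool (i = j)) (P $ i $ j) (a $ j) (k $ j)) = (\<chi> j. ?s j *s ?M $ j)"
    by (simp add: vec_eq_iff)
  thus ?thesis
    unfolding good_det_def using det_rows_mul[of ?s "\<lambda>j. ?M $ j"] by simp
qed

text \<open>
  The rows of the matrix in \<open>good_det_factor\<close> are dependent: weighted by 1 where $k_j > 0$ and by $a_j$ where $k_j = 0$, they add up
  to $a - Pk$, which vanishes for $c = 0$.
\<close>

lemma good_coeff_zero:
  fixes P :: "real^'n^'n"
  assumes "k \<noteq> 0"
  shows "good_coeff P 0 k = 0"
proof -
  define a where "a = P *v of_nat_vec k"
  define M :: "real^'n^'n" where
    "M = (\<chi> j i. if k $ j = 0 then of_bool (i = j)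
                else a $ j * of_bool (i = j) - P $ i $ j * real (k $ j))"
  define v :: "real^'n" where "v = (\<chi> j. if k $ j = 0 then a $ j else 1)"
  have "(transpose M *v v) $ i = 0" for i
  proof -
    have "(transpose M *v v) $ i = (\<Sum>j\<in>UNIV. M $ j $ i * v $ j)"
      by (simp add: matrix_vector_mult_def transpose_def)
    also have "\<dots> = (\<Sum>j\<in>UNIV. (if i = j then a $ i else 0) - P $ i $ j * real (k $ j))"
      by (intro sum.cong refl) (auto simp: M_def v_def)
    also have "\<dots> = a $ i - (\<Sum>j\<in>UNIV. P $ i $ j * real (k $ j))"
      by (simp add: sum_subtractf)
    also have "\<dots> = 0"
      by (simp add: a_def matrix_vector_mult_def of_nat_vec_def)
    finally show ?thesis .
  qed
  hence 1: "transpose M *v v = 0" by (simp add: vec_eq_iff)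
  obtain j where "k $ j \<noteq> 0" using assms by (auto simp: vec_eq_iff)
  hence "v $ j \<noteq> 0" by (simp add: v_def)
  hence "v \<noteq> 0" by auto
  with 1 have "\<not> invertible (transpose M)"
    by (auto simp: invertible_left_inverse matrix_left_invertible_ker)
  hence "det M = 0" by (simp add: invertible_det_nz det_transpose)
  thus ?thesis
    unfolding good_coeff_def good_det_factor add_0 by (simp only: M_def a_def mult_zero_right)
qed

text \<open>\<open>coeff\<close> scales columns where \<open>good_det_factor\<close> scales rows, so
  the two matrices are compared after a transposition. The scalars agree because a Pochhammer symbol
  of length k_j - 1 is (k_j - 1)! times a binomial, and (k_j - 1)!/k_j! = 1/k_j.\<close>

lemma coeff_eq_good_coeff:
  "coeff K B d k = good_coeff (matrix_inv K ** B) (matrix_inv K *v d) k"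
proof -
  define P where "P = matrix_inv K ** B"
  define a where "a = matrix_inv K *v d + P *v of_nat_vec k"
  define M where "M = (\<chi> j i. if k $ j = 0 then of_bool (i = j)
                else a $ j * of_bool (i = j) - P $ i $ j * real (k $ j))"
  define s where "s j = (if k $ j = 0 then 1 else pochhammer (a $ j - real (k $ j) + 1) (k $ j - 1))" for j
  have g: "gamma_ratio (a $ j) (a $ j - real (k $ j) + 1) = pochhammer (a $ j - real (k $ j) + 1) (k $ j - 1)"
    if "k $ j \<noteq> 0" for j
  proof -
    \<comment> \<open>The two Gamma arguments differ by the natural number k_j - 1, which selects
      the polynomial branch of \<open>gamma_ratio\<close>.\<close>
    have e: "a $ j - (a $ j - real (k $ j) + 1) = real (k $ j - 1)"
      using that by (simp add: of_nat_diff)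
    have "a $ j - real (k $ j) + 1 \<le> a $ j" using that by simp
    thus ?thesis unfolding gamma_ratio_def e by (simp only: Ints_of_nat if_True floor_of_nat nat_int)
  qed
  define N where "N = (\<chi> i j. if k $ j = 0 then (if i = j then 1 else 0)
                      else (diag_mat a - P ** diag_mat (of_nat_vec k)) $ i $ j * gamma_ratio (a $ j) (a $ j - real (k $ j) + 1))"
  have Pd: "(P ** diag_mat (of_nat_vec k)) $ i $ j = P $ i $ j * real (k $ j)" for i j
    by (simp add: matrix_matrix_mult_def diag_mat_def of_nat_vec_def if_distrib cong: if_cong)
  have "N $ i $ j = s j * M $ j $ i" for i j
    by (cases "k $ j = 0") (simp_all add: N_def s_def M_def g Pd, simp add: diag_mat_def)
  hence "transpose N = (\<chi> j. s j *s M $ j)"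
    by (simp add: vec_eq_iff transpose_def)
  hence dN: "det N = (\<Prod>j\<in>UNIV. s j) * det M"
    using det_rows_mul[of s "\<lambda>j. M $ j"] det_transpose[of N] by simp
  have c: "coeff K B d k = (-1) ^ (\<Sum>j\<in>UNIV. k $ j) / (\<Prod>j\<in>UNIV. fact (k $ j)) * det N"
    unfolding coeff_def Let_def N_def a_def P_def arg_vec_def by (simp only:)
  have "(-1) ^ (\<Sum>j\<in>UNIV. k $ j) / (\<Prod>j\<in>UNIV. fact (k $ j)) * (\<Prod>j\<in>UNIV. s j)
     = (\<Prod>j\<in>UNIV. (-1) ^ (k $ j) / fact (k $ j) * s j)"
    by (simp add: power_sum prod.distrib prod_dividef)
  also have "\<dots> = (\<Prod>j\<in>UNIV. if k $ j = 0 then 1 else (-1) ^ (k $ j) * ((a $ j - 1) gchoose (k $ j - 1)) / real (k $ j))"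
  proof (intro prod.cong refl)
    fix j
    show "(-1) ^ (k $ j) / fact (k $ j) * s j = (if k $ j = 0 then 1 else (-1) ^ (k $ j) * ((a $ j - 1) gchoose (k $ j - 1)) / real (k $ j))"
    proof (cases "k $ j")
      case (Suc m)
      have "(a $ j - 1) gchoose m = pochhammer (a $ j - 1 - real m + 1) m / fact m"
        by (rule gbinomial_pochhammer')
      hence "s j = ((a $ j - 1) gchoose m) * fact m"
        using Suc by (simp add: s_def algebra_simps)
      thus ?thesis using Suc by (simp del: of_nat_Suc)
    qed (simp add: s_def)
  qed
  finally have "coeff K B d k = good_det P a k"
    unfolding c dN good_det_factor M_def by (simp only: mult.assoc[symmetric])
  thus ?thesis by (simp add: good_coeff_def P_def a_def)
qed

section \<open>Polynomial dependence on the exponent\<close>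

definition polynomial_in :: "(real \<Rightarrow> complex) \<Rightarrow> bool" where
  "polynomial_in f \<longleftrightarrow> (\<exists>p. \<forall>s. f s = poly p (of_real s))"

lemma polynomial_in_const: "polynomial_in (\<lambda>s. c)"
  unfolding polynomial_in_def by (rule exI[of _ "[:c:]"]) simp

lemma polynomial_in_of_real: "polynomial_in of_real"
  unfolding polynomial_in_def by (rule exI[of _ "[:0, 1:]"]) simp

lemma polynomial_in_add: "polynomial_in f \<Longrightarrow> polynomial_in g \<Longrightarrow> polynomial_in (\<lambda>s. f s + g s)"
  unfolding polynomial_in_def by (metis poly_add)

lemma polynomial_in_mult: "polynomial_in f \<Longrightarrow> polynomial_in g \<Longrightarrow> polynomial_in (\<lambda>s. f s * g s)"
  unfolding polynomial_in_def by (metis poly_mult)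

lemma polynomial_in_diff: "polynomial_in f \<Longrightarrow> polynomial_in g \<Longrightarrow> polynomial_in (\<lambda>s. f s - g s)"
  unfolding polynomial_in_def by (metis poly_diff)

lemma polynomial_in_sum: "(\<And>x. x \<in> A \<Longrightarrow> polynomial_in (f x)) \<Longrightarrow> polynomial_in (\<lambda>s. \<Sum>x\<in>A. f x s)"
  by (induction A rule: infinite_finite_induct) (auto intro: polynomial_in_add polynomial_in_const)

lemma polynomial_in_prod: "(\<And>x. x \<in> A \<Longrightarrow> polynomial_in (f x)) \<Longrightarrow> polynomial_in (\<lambda>s. \<Prod>x\<in>A. f x s)"
  by (induction A rule: infinite_finite_induct) (auto intro: polynomial_in_mult polynomial_in_const)

lemmas polynomial_in_intros = polynomial_in_const polynomial_in_of_real polynomial_in_add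
  polynomial_in_mult polynomial_in_diff polynomial_in_sum polynomial_in_prod

text \<open>Periodicity makes every natural number a root of p - f(0), and a nonzero polynomial has
  only finitely many roots.\<close>

lemma polynomial_in_periodic_imp_const:
  assumes "polynomial_in f" and per: "\<And>s. f (s + 1) = f s"
  shows "f s = f 0"
proof -
  obtain p where p: "\<And>s. f s = poly p (of_real s)"
    using assms(1) unfolding polynomial_in_def by blast
  define q where "q = p - [:f 0:]"
  have "f (real n) = f 0" for n
  proof (induction n)
    case (Suc n)
    then show ?case using per[of "real n"] by (simp add: add.commute)
  qed simp
  hence "range (of_nat :: nat \<Rightarrow> complex) \<subseteq> {x. poly q x = 0}"
    using p by (auto simp: q_def)
  moreover have "infinite (range (of_nat :: nat \<Rightarrow> complex))"
    using inj_of_nat by (rule range_inj_infinite)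
  ultimately have "q = 0" using poly_roots_finite finite_subset by blast
  hence "poly p (of_real s) = f 0" by (simp add: q_def)
  thus ?thesis by (simp add: p)
qed

lemma polynomial_in_gbinomial:
  assumes "polynomial_in (\<lambda>s. of_real (f s))"
  shows "polynomial_in (\<lambda>s. of_real (f s gchoose k))"
  unfolding gbinomial_prod_rev divide_inverse of_real_mult of_real_prod of_real_diff
  by (intro polynomial_in_intros assms)

lemma polynomial_in_good_coeff:
  fixes P :: "real^'n^'n"
  shows "polynomial_in (\<lambda>s. of_real (good_coeff P (c + s *\<^sub>R axis l 1) k))"
proof -
  have a: "polynomial_in (\<lambda>s. of_real ((c + s *\<^sub>R axis l 1 + P *v of_nat_vec k) $ j))" for j
    by (auto intro!: polynomial_in_intros)
  have a1: "polynomial_in (\<lambda>s. of_real ((c + s *\<^sub>R axis l 1 + P *v of_nat_vec k) $ j - 1))" for j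
    using polynomial_in_diff[OF a polynomial_in_const[of 1]] by simp
  have t: "polynomial_in (\<lambda>s. of_real (trinomial_entry \<delta> p ((c + s *\<^sub>R axis l 1 + P *v of_nat_vec k) $ j) m))"
    for \<delta> p j m
    unfolding trinomial_entry_def of_real_mult of_real_diff
    by (cases "m = 0")
      (simp_all only: if_True if_False simp_thms,
       (intro polynomial_in_intros polynomial_in_gbinomial a a1)+)
  show ?thesis
    unfolding good_coeff_def good_det_def det_def of_real_sum of_real_mult of_real_prod vec_lambda_beta
    by (intro polynomial_in_intros t)
qed

text \<open>Starting from 0, the coordinates of c are switched on one at a time; S is the set of
  those already switched on.\<close>

lemma const_along_axes_imp_const:
  fixes f :: "real^'n \<Rightarrow> 'b"
  assumes "\<And>c l s. f (c + s *\<^sub>R axis l 1) = f c"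
  shows "f c = f 0"
proof -
  have "f (\<chi> j. if j \<in> S then c $ j else 0) = f 0" if "finite S" for S
    using that
  proof (induction S)
    case empty
    then show ?case by (simp add: zero_vec_def)
  next
    case (insert l S)
    have "(\<chi> j. if j \<in> insert l S then c $ j else 0) = (\<chi> j. if j \<in> S then c $ j else 0) + (c $ l) *\<^sub>R axis l 1"
      using insert by (auto simp: vec_eq_iff axis_def)
    then show ?case using assms insert by simp
  qed
  from this[of UNIV] show ?thesis by (simp add: vec_lambda_eta)
qed

section \<open>Homogeneous parts\<close>

definition total_degree :: "nat^'n \<Rightarrow> nat" where
  "total_degree k = (\<Sum>j\<in>UNIV. k $ j)"

lemma component_le_total_degree: "k $ j \<le> total_degree k"
  unfolding total_degree_def by (rule member_le_sum) auto

lemma finite_total_degree: "finite {k :: nat^'n. total_degree k = m}"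
proof (rule finite_subset)
  show "{k :: nat^'n. total_degree k = m} \<subseteq> vec_lambda ` PiE UNIV (\<lambda>_. {..m})"
  proof
    fix k :: "nat^'n" assume "k \<in> {k. total_degree k = m}"
    hence "vec_nth k \<in> PiE UNIV (\<lambda>_. {..m})"
      using component_le_total_degree[of k] by auto
    thus "k \<in> vec_lambda ` PiE UNIV (\<lambda>_. {..m})"
      by (metis image_eqI vec_nth_inverse)
  qed
qed (auto intro!: finite_imageI finite_PiE)

lemma total_degree_add_axis: "total_degree (k + axis l 1) = Suc (total_degree k)"
  by (simp add: total_degree_def sum.distrib axis_def)

lemma monomial_add_axis: "monomial r (k + axis l 1) = r $ l * monomial r k"
proof -
  have "(\<Prod>j\<in>UNIV. (r $ j) ^ (axis l 1 $ j)) = (\<Prod>j\<in>UNIV. if j = l then r $ l else 1)"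
    by (intro prod.cong) (auto simp: axis_def)
  also have "\<dots> = r $ l" by simp
  finally show ?thesis
    by (simp add: monomial_def power_add prod.distrib del: One_nat_def)
qed

lemma diff_add_axis:
  fixes k :: "nat^'n"
  assumes "k $ l > 0"
  shows "k - axis l 1 + axis l 1 = k"
  using assms by (auto simp: vec_eq_iff axis_def)

text \<open>The homogeneous part of degree m of the claimed series, that is, the coefficient of t^m
  once r is replaced by t r.\<close>

definition good_hom :: "real^'n^'n \<Rightarrow> complex^'n \<Rightarrow> nat \<Rightarrow> real^'n \<Rightarrow> complex" where
  "good_hom P r m c = (\<Sum>k | total_degree k = m. of_real (good_coeff P c k) * monomial r k)"

lemma good_hom_0 [simp]:
  fixes P :: "real^'n^'n"
  shows "good_hom P r 0 c = 1"
proof -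
  have "{k :: nat^'n. total_degree k = 0} = {0}"
    by (auto simp: total_degree_def vec_eq_iff)
  thus ?thesis by (simp add: good_hom_def monomial_def)
qed

lemma good_hom_zero: "m > 0 \<Longrightarrow> good_hom P r m 0 = 0"
  unfolding good_hom_def
  by (rule sum.neutral) (auto intro: good_coeff_zero simp: total_degree_def)

text \<open>Multiply \<open>good_coeff_rec\<close> by r^k and sum over |k| = m + 1. Indices with k_l
  = 0 cancel by \<open>good_coeff_shift\<close>; the others are reindexed by removing e_l, which
  releases one factor r_l.\<close>

lemma good_hom_rec:
  fixes P :: "real^'n^'n"
  shows "good_hom P r (Suc m) c =
    good_hom P r (Suc m) (c + axis l 1) + r $ l * good_hom P r m (c + column l P)"
proof -
  let ?S = "\<lambda>m. {k :: nat^'n. total_degree k = m}"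
  let ?g = "\<lambda>k. of_real (good_coeff P (c + column l P) k) * monomial r k"
  have "good_hom P r (Suc m) c - good_hom P r (Suc m) (c + axis l 1) =
     (\<Sum>k\<in>?S (Suc m). of_real (good_coeff P c k - good_coeff P (c + axis l 1) k) * monomial r k)"
    by (simp add: good_hom_def sum_subtractf left_diff_distrib)
  also have "\<dots> = (\<Sum>k\<in>{k \<in> ?S (Suc m). k $ l > 0}.
      of_real (good_coeff P c k - good_coeff P (c + axis l 1) k) * monomial r k)"
    by (rule sum.mono_neutral_right) (auto simp: finite_total_degree good_coeff_shift)
  also have "\<dots> = (\<Sum>k\<in>{k \<in> ?S (Suc m). k $ l > 0}. r $ l * ?g (k - axis l 1))"
  proof (rule sum.cong)
    fix k assume k: "k \<in> {k \<in> ?S (Suc m). k $ l > 0}"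
    have "monomial r k = r $ l * monomial r (k - axis l 1)"
      using k monomial_add_axis[of r "k - axis l 1" l] diff_add_axis[of k l] by simp
    thus "of_real (good_coeff P c k - good_coeff P (c + axis l 1) k) * monomial r k = r $ l * ?g (k - axis l 1)"
      using k good_coeff_rec[of k l P c] by simp
  qed simp
  also have "\<dots> = (\<Sum>k\<in>?S m. r $ l * ?g k)"
  proof (rule sum.reindex_bij_witness[of _ "\<lambda>k. k + axis l 1" "\<lambda>k. k - axis l 1"])
    fix k assume k: "k \<in> {k \<in> ?S (Suc m). k $ l > 0}"
    show "k - axis l 1 + axis l 1 = k" using k diff_add_axis[of k l] by simp
    show "k - axis l 1 \<in> ?S m"
      using k diff_add_axis[of k l] total_degree_add_axis[of "k - axis l 1" l] by simp
  qed (use total_degree_add_axis in \<open>auto simp: vec_eq_iff\<close>)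
  also have "\<dots> = r $ l * good_hom P r m (c + column l P)"
    by (simp add: good_hom_def sum_distrib_left)
  finally show ?thesis by (simp add: algebra_simps)
qed

lemma polynomial_in_good_hom:
  "polynomial_in (\<lambda>s. good_hom P r m (c + s *\<^sub>R axis l 1))"
  unfolding good_hom_def by (intro polynomial_in_intros polynomial_in_good_coeff)

section \<open>Growth and summability\<close>

lemma power_over_fact_le_exp:
  assumes "x \<ge> (0::real)"
  shows "x ^ n / fact n \<le> exp x"
proof -
  have "(\<lambda>n. x ^ n / fact n) sums exp x"
    using exp_converges[of x] by (simp add: divide_inverse mult.commute)
  from sum_le_suminf[OF sums_summable[OF this], of "{n}"] sums_unique[OF this] assms
  show ?thesis by simp
qed

text \<open>Each of the k factors in the numerator is at most |a| + k, and x^k / k! is a single term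
  of the series of exp x.\<close>

lemma abs_gbinomial_le_exp: "\<bar>(a::real) gchoose k\<bar> \<le> exp (\<bar>a\<bar> + real k)"
proof -
  have "\<bar>a gchoose k\<bar> = (\<Prod>i=0..<k. \<bar>a - real i\<bar>) / fact k"
    by (simp add: gbinomial_prod_rev abs_prod)
  also have "\<dots> \<le> (\<Prod>i=0..<k. \<bar>a\<bar> + real k) / fact k"
    by (intro divide_right_mono prod_mono) auto
  also have "\<dots> = (\<bar>a\<bar> + real k) ^ k / fact k" by simp
  also have "\<dots> \<le> exp (\<bar>a\<bar> + real k)" by (rule power_over_fact_le_exp) simp
  finally show ?thesis .
qed

lemma abs_trinomial_entry_le:
  "\<bar>trinomial_entry \<delta> p a k\<bar> \<le> (\<bar>\<delta>\<bar> + \<bar>p\<bar>) * exp (\<bar>a\<bar> + real k)"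
proof -
  have 1: "\<bar>if k = 0 then 0 else (a - 1) gchoose (k - 1)\<bar> \<le> exp (\<bar>a\<bar> + real k)" (is "\<bar>?q\<bar> \<le> _")
  proof (cases k)
    case (Suc m)
    have "exp (\<bar>a - 1\<bar> + real m) \<le> exp (\<bar>a\<bar> + real k)" using Suc by simp
    from order_trans[OF abs_gbinomial_le_exp this] show ?thesis using Suc by simp
  qed simp
  have "\<bar>trinomial_entry \<delta> p a k\<bar> = \<bar>\<delta> * (a gchoose k) - p * ?q\<bar>"
    unfolding trinomial_entry_def abs_mult power_abs by (simp only: abs_minus abs_one power_one mult_1)
  also have "\<dots> \<le> \<bar>\<delta> * (a gchoose k)\<bar> + \<bar>p * ?q\<bar>" by (rule abs_triangle_ineq4)
  also have "\<dots> = \<bar>\<delta>\<bar> * \<bar>a gchoose k\<bar> + \<bar>p\<bar> * \<bar>?q\<bar>" by (simp only: abs_mult)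
  also have "\<dots> \<le> \<bar>\<delta>\<bar> * exp (\<bar>a\<bar> + real k) + \<bar>p\<bar> * exp (\<bar>a\<bar> + real k)"
    by (intro add_mono mult_left_mono abs_gbinomial_le_exp 1) auto
  finally show ?thesis by (simp add: algebra_simps)
qed

text \<open>The bound b depends on the row only, so every term of the Leibniz expansion is dominated
  by the same product.\<close>

lemma abs_det_le:
  fixes A :: "real^'n^'n"
  assumes "\<And>i j. \<bar>A $ i $ j\<bar> \<le> b i"
  shows "\<bar>det A\<bar> \<le> real (card {p. p permutes (UNIV :: 'n set)}) * (\<Prod>i\<in>UNIV. b i)"
proof -
  have "\<bar>det A\<bar> \<le> (\<Sum>p | p permutes (UNIV :: 'n set). \<bar>of_int (sign p) * (\<Prod>i\<in>UNIV. A $ i $ p i)\<bar>)"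
    unfolding det_def by (rule sum_abs)
  also have "\<dots> \<le> (\<Sum>p | p permutes (UNIV :: 'n set). \<Prod>i\<in>UNIV. b i)"
    using assms by (intro sum_mono) (auto simp: abs_mult sign_def abs_prod intro!: prod_mono)
  finally show ?thesis by simp
qed

text \<open>The entries of c + Pk grow at most linearly in |k|, so each row is at most exponential
  in |k|. The base B does not depend on c; this yields one radius of convergence for all
  exponents.\<close>

lemma good_coeff_bound:
  fixes P :: "real^'n^'n"
  obtains B where "B > 0" and "\<And>c. \<exists>A\<ge>0. \<forall>k. \<bar>good_coeff P c k\<bar> \<le> A * B ^ total_degree k"
proof -
  define q where "q = (\<Sum>i\<in>UNIV. \<Sum>j\<in>UNIV. \<bar>P $ i $ j\<bar>)"
  have q0: "q \<ge> 0" unfolding q_def by (intro sum_nonneg) auto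
  have q: "\<bar>P $ i $ j\<bar> \<le> q" for i j
  proof -
    have "\<bar>P $ i $ j\<bar> \<le> (\<Sum>j\<in>UNIV. \<bar>P $ i $ j\<bar>)" by (rule member_le_sum) auto
    also have "\<dots> \<le> q" unfolding q_def by (rule member_le_sum) (auto intro: sum_nonneg)
    finally show ?thesis .
  qed
  define N where "N = real CARD('n)"
  \<comment> \<open>Each of the N rows contributes exp(q |k|), and the factors exp(k_j) together
    contribute exp(|k|).\<close>
  define B where "B = exp (N * q + 1)"
  have "\<exists>A\<ge>0. \<forall>k. \<bar>good_coeff P c k\<bar> \<le> A * B ^ total_degree k" for c
  proof (intro exI conjI allI)
    let ?C = "real (card {p. p permutes (UNIV :: 'n set)})"
    let ?A = "?C * (1 + q) ^ CARD('n) * exp (\<Sum>j\<in>UNIV. \<bar>c $ j\<bar>)"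
    show "?A \<ge> 0" using q0 by simp
    fix k :: "nat^'n"
    let ?a = "c + P *v of_nat_vec k"
    have a: "\<bar>?a $ j\<bar> \<le> \<bar>c $ j\<bar> + q * real (total_degree k)" for j
    proof -
      have "\<bar>(P *v of_nat_vec k) $ j\<bar> \<le> (\<Sum>i\<in>UNIV. \<bar>P $ j $ i * real (k $ i)\<bar>)"
        by (simp add: matrix_vector_mult_def of_nat_vec_def)
      also have "\<dots> \<le> (\<Sum>i\<in>UNIV. q * real (k $ i))"
        by (intro sum_mono) (auto simp: abs_mult intro!: mult_right_mono q)
      also have "\<dots> = q * real (total_degree k)"
        by (simp add: total_degree_def sum_distrib_left)
      finally show ?thesis by simp
    qed
    let ?b = "\<lambda>j. (1 + q) * exp (\<bar>c $ j\<bar> + q * real (total_degree k) + real (k $ j))"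
    have "\<bar>trinomial_entry (of_bool (i = j)) (P $ i $ j) (?a $ j) (k $ j)\<bar> \<le> ?b j" for i j
    proof -
      have "\<bar>trinomial_entry (of_bool (i = j)) (P $ i $ j) (?a $ j) (k $ j)\<bar>
        \<le> (\<bar>of_bool (i = j)\<bar> + \<bar>P $ i $ j\<bar>) * exp (\<bar>?a $ j\<bar> + real (k $ j))"
        by (rule abs_trinomial_entry_le)
      also have "\<dots> \<le> ?b j"
        using q[of i j] q0 a[of j] by (intro mult_mono) auto
      finally show ?thesis .
    qed
    hence "\<bar>good_coeff P c k\<bar> \<le> ?C * (\<Prod>j\<in>UNIV. ?b j)"
      unfolding good_coeff_def good_det_def by (intro abs_det_le) simp
    also have "(\<Prod>j\<in>UNIV. ?b j) = (1 + q) ^ CARD('n) *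
        exp (\<Sum>j\<in>UNIV. \<bar>c $ j\<bar> + q * real (total_degree k) + real (k $ j))"
      by (simp add: prod.distrib exp_sum)
    also have "(\<Sum>j\<in>UNIV. \<bar>c $ j\<bar> + q * real (total_degree k) + real (k $ j)) =
        (\<Sum>j\<in>UNIV. \<bar>c $ j\<bar>) + real (total_degree k) * (N * q + 1)"
      by (simp add: sum.distrib N_def total_degree_def algebra_simps)
    also have "exp \<dots> = exp (\<Sum>j\<in>UNIV. \<bar>c $ j\<bar>) * B ^ total_degree k"
      by (simp add: exp_add B_def exp_of_nat_mult)
    finally show "\<bar>good_coeff P c k\<bar> \<le> ?A * B ^ total_degree k"
      by (simp add: mult_ac)
  qed
  moreover have "B > 0" by (simp add: B_def)
  ultimately show ?thesis using that by blast
qed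

text \<open>A finite index set lies in a box, where the sum factors into n truncated geometric
  series, each at most 1/(1 - q).\<close>

lemma summable_on_power_total_degree:
  assumes "0 \<le> q" "q < (1::real)"
  shows "(\<lambda>k :: nat^'n. q ^ total_degree k) summable_on UNIV"
proof (rule nonneg_bdd_above_summable_on)
  show "bdd_above (sum (\<lambda>k :: nat^'n. q ^ total_degree k) ` {F. F \<subseteq> UNIV \<and> finite F})"
  proof (rule bdd_aboveI2)
    fix F :: "(nat^'n) set" assume "F \<in> {F. F \<subseteq> UNIV \<and> finite F}"
    hence F: "finite F" by simp
    define m where "m = (\<Sum>k\<in>F. total_degree k)"
    have sub: "vec_nth ` F \<subseteq> PiE UNIV (\<lambda>_. {..m})"
    proof -
      have "k $ j \<le> m" if "k \<in> F" for k j
        using component_le_total_degree[of k j] member_le_sum[OF that, of total_degree] F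
        unfolding m_def by simp
      thus ?thesis by auto
    qed
    have "(\<Sum>k\<in>F. q ^ total_degree k) = (\<Sum>f\<in>vec_nth ` F. \<Prod>j\<in>UNIV. q ^ f j)"
      by (subst sum.reindex) (auto simp: inj_on_def vec_nth_inject total_degree_def power_sum)
    also have "\<dots> \<le> (\<Sum>f\<in>PiE (UNIV :: 'n set) (\<lambda>_. {..m}). \<Prod>j\<in>UNIV. q ^ f j)"
      by (rule sum_mono2[OF _ sub]) (auto intro!: finite_PiE prod_nonneg simp: assms)
    also have "\<dots> = (\<Prod>j\<in>(UNIV::'n set). \<Sum>i\<le>m. q ^ i)"
      by (rule prod_sum_PiE[symmetric]) auto
    also have "\<dots> \<le> (\<Prod>j\<in>(UNIV::'n set). 1 / (1 - q))"
    proof (intro prod_mono conjI)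
      have "(\<Sum>i\<le>m. q ^ i) \<le> suminf (\<lambda>i. q ^ i)"
        using assms by (intro sum_le_suminf summable_geometric) auto
      thus "(\<Sum>i\<le>m. q ^ i) \<le> 1 / (1 - q)" using assms by (simp add: suminf_geometric)
    qed (use assms in \<open>auto intro: sum_nonneg\<close>)
    finally show "(\<Sum>k\<in>F. q ^ total_degree k) \<le> (\<Prod>j\<in>(UNIV::'n set). 1 / (1 - q))" .
  qed
qed (use assms in auto)

text \<open>Absolute convergence allows the series over multi-indices to be regrouped by total
  degree, so its sum must be that of the series of homogeneous parts.\<close>

lemma good_series_has_sum:
  fixes P :: "real^'n^'n"
  obtains \<epsilon> where "\<epsilon> > 0" and
    "\<And>c r S. (\<And>j. norm (r $ j) \<le> \<epsilon>) \<Longrightarrow> (\<lambda>m. good_hom P r m c) sums S \<Longrightarrow>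
       ((\<lambda>k. of_real (good_coeff P c k) * monomial r k) has_sum S) UNIV"
proof -
  obtain B where B: "B > 0" and bound: "\<And>c. \<exists>A\<ge>0. \<forall>k. \<bar>good_coeff P c k\<bar> \<le> A * B ^ total_degree k"
    by (rule good_coeff_bound[of P]) blast
  \<comment> \<open>With this radius the term of index k is at most A / 2^|k|.\<close>
  define \<epsilon> where "\<epsilon> = 1 / (2 * B)"
  have \<epsilon>: "\<epsilon> > 0" "B * \<epsilon> = 1 / 2" using B by (simp_all add: \<epsilon>_def)
  show ?thesis
  proof (rule that[of \<epsilon>])
    show "\<epsilon> > 0" by fact
    fix c :: "real^'n" and r :: "complex^'n" and S
    assume r: "\<And>j. norm (r $ j) \<le> \<epsilon>" and S: "(\<lambda>m. good_hom P r m c) sums S"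
    let ?f = "\<lambda>k. of_real (good_coeff P c k) * monomial r k"
    obtain A where A: "A \<ge> 0" "\<And>k. \<bar>good_coeff P c k\<bar> \<le> A * B ^ total_degree k"
      using bound by blast
    have le: "norm (?f k) \<le> A * (1 / 2) ^ total_degree k" for k
    proof -
      have "norm (monomial r k) \<le> (\<Prod>j\<in>UNIV. \<epsilon> ^ (k $ j))"
        unfolding monomial_def prod_norm[symmetric] norm_power using r
        by (intro prod_mono conjI power_mono) auto
      also have "\<dots> = \<epsilon> ^ total_degree k" by (simp add: total_degree_def power_sum)
      finally have "norm (?f k) \<le> (A * B ^ total_degree k) * \<epsilon> ^ total_degree k"
        unfolding norm_mult norm_of_real using A B by (intro mult_mono) auto
      thus ?thesis by (simp add: \<epsilon>(2)[symmetric] power_mult_distrib mult.assoc)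
    qed
    have "(\<lambda>k. A * (1 / 2) ^ total_degree k) summable_on (UNIV :: (nat^'n) set)"
      by (intro summable_on_cmult_right summable_on_power_total_degree) auto
    hence "(\<lambda>k. norm (?f k)) summable_on UNIV"
      by (rule Infinite_Sum.abs_summable_on_comparison_test') (rule le)
    hence "?f summable_on UNIV" by (rule abs_summable_summable)
    then obtain T where T: "(?f has_sum T) UNIV" by (auto simp: summable_on_def)
    let ?g = "\<lambda>(m::nat, k). ?f k"
    have bij: "bij_betw (\<lambda>k. (total_degree k, k)) UNIV (Sigma UNIV (\<lambda>m. {k :: nat^'n. total_degree k = m}))"
      by (rule bij_betwI[where g = snd]) auto
    have "(?g has_sum T) (Sigma UNIV (\<lambda>m. {k :: nat^'n. total_degree k = m}))"
      using T has_sum_reindex_bij_betw[OF bij, of ?g T] by simp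
    moreover have "((\<lambda>k. ?g (m, k)) has_sum good_hom P r m c) {k :: nat^'n. total_degree k = m}" for m
      unfolding good_hom_def by (simp add: has_sum_finite finite_total_degree)
    ultimately have "((\<lambda>m. good_hom P r m c) has_sum T) UNIV"
      by (rule has_sum_SigmaD)
    hence "(\<lambda>m. good_hom P r m c) sums T" by (rule has_sum_imp_sums)
    with S have "S = T" by (rule sums_unique2)
    with T show "(?f has_sum S) UNIV" by simp
  qed
qed

section \<open>The holomorphic family of solutions\<close>

text \<open>On this convex disc the real part is at least 1/2, so it avoids the branch cut and the
  derivative 1/z is bounded by 2.\<close>

lemma norm_Ln_diff_le:
  assumes "norm (a - 1) \<le> 1 / 2" "norm (b - 1) \<le> 1 / 2"
  shows "norm (Ln a - Ln b) \<le> 2 * norm (a - b)"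
proof (rule field_differentiable_bound[of "cball 1 (1 / 2)" Ln inverse 2])
  fix z :: complex assume z: "z \<in> cball 1 (1 / 2)"
  hence z': "norm (1 - z) \<le> 1 / 2" by (simp add: dist_norm)
  have "Re z \<ge> 1 / 2" using abs_Re_le_cmod[of "1 - z"] z' by simp
  hence "z \<notin> \<real>\<^sub>\<le>\<^sub>0" by (auto simp: complex_nonpos_Reals_iff)
  thus "(Ln has_field_derivative inverse z) (at z within cball 1 (1 / 2))"
    by (rule has_field_derivative_at_within[OF has_field_derivative_Ln])
  have "norm z \<ge> 1 / 2" using \<open>Re z \<ge> 1 / 2\<close> complex_Re_le_cmod[of z] by linarith
  thus "norm (inverse z) \<le> 2"
    using le_imp_inverse_le[of "1 / 2" "norm z"] by (simp add: norm_inverse)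
qed (use assms in \<open>auto simp: dist_norm norm_minus_commute\<close>)

lemma norm_exp_diff_le:
  assumes "norm x \<le> L" "norm (y :: complex) \<le> L"
  shows "norm (exp x - exp y) \<le> exp L * norm (x - y)"
proof (rule field_differentiable_bound[of "cball 0 L" exp exp "exp L"])
  fix z :: complex assume "z \<in> cball 0 L"
  thus "norm (exp z) \<le> exp L" using complex_Re_le_cmod[of z] by simp
  show "(exp has_field_derivative exp z) (at z within cball 0 L)"
    by (rule has_field_derivative_at_within[OF DERIV_exp])
qed (use assms in auto)

section \<open>The contraction in logarithmic variables\<close>

definition weight :: "real^'n^'n \<Rightarrow> real" where
  "weight P = (\<Sum>i\<in>UNIV. \<Sum>l\<in>UNIV. \<bar>P $ l $ i\<bar>)"

text \<open>The factor exp(-L), with L = \<open>weight P\<close>, cancels the growth of exp on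
  exponent sums. The factor 1/(4(L+1)) keeps the argument of \<open>Ln\<close> within 1/4 of 1 and
  gives the map below Lipschitz constant 1/2 on the unit polydisc.\<close>

definition trinomial_radius :: "real^'n^'n \<Rightarrow> real" where
  "trinomial_radius P = exp (- weight P) / (4 * (weight P + 1))"

definition exponent_sum :: "real^'n^'n \<Rightarrow> ('n \<Rightarrow> complex) \<Rightarrow> 'n \<Rightarrow> complex" where
  "exponent_sum P v i = (\<Sum>l\<in>UNIV. of_real (P $ l $ i) * v l)"

text \<open>The system e^(u_i) + r_i e^(s_i(u)) = 1, with s_i(u) =
  \<open>exponent_sum P u i\<close>, solved for the first u_i by the principal logarithm; small
  solutions are its fixed points.\<close>

definition trinomial_map :: "real^'n^'n \<Rightarrow> complex^'n \<Rightarrow> ('n \<Rightarrow> complex) \<Rightarrow> 'n \<Rightarrow> complex" where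
  "trinomial_map P r v i = Ln (1 - r $ i * exp (exponent_sum P v i))"

lemma weight_nonneg: "weight P \<ge> 0"
  unfolding weight_def by (intro sum_nonneg) auto

lemma trinomial_radius_pos: "trinomial_radius P > 0"
  unfolding trinomial_radius_def using weight_nonneg[of P] by simp

lemma norm_exponent_sum_le:
  assumes "\<And>l. norm (v l) \<le> D"
  shows "norm (exponent_sum P v i) \<le> weight P * D"
proof -
  have D: "D \<ge> 0" using assms[of undefined] norm_ge_zero order_trans by blast
  have "norm (exponent_sum P v i) \<le> (\<Sum>l\<in>UNIV. norm (of_real (P $ l $ i) * v l))"
    unfolding exponent_sum_def by (rule norm_sum)
  also have "\<dots> \<le> (\<Sum>l\<in>UNIV. \<bar>P $ l $ i\<bar> * D)"
    by (intro sum_mono) (auto simp: norm_mult intro!: mult_left_mono assms)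
  also have "\<dots> = (\<Sum>l\<in>UNIV. \<bar>P $ l $ i\<bar>) * D" by (simp add: sum_distrib_right)
  also have "\<dots> \<le> weight P * D"
    unfolding weight_def
    by (intro mult_right_mono D member_le_sum[of i UNIV "\<lambda>i. \<Sum>l\<in>UNIV. \<bar>P $ l $ i\<bar>"])
       (auto intro: sum_nonneg)
  finally show ?thesis .
qed

lemma exponent_sum_diff:
  "exponent_sum P v i - exponent_sum P v' i = exponent_sum P (\<lambda>l. v l - v' l) i"
  by (simp add: exponent_sum_def sum_subtractf right_diff_distrib)

lemma trinomial_arg_small:
  assumes "norm (r $ i) \<le> trinomial_radius P" "\<And>l. norm (v l) \<le> 1"
  shows "norm (r $ i * exp (exponent_sum P v i)) \<le> 1 / 4"
proof -
  have "Re (exponent_sum P v i) \<le> weight P"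
    using norm_exponent_sum_le[of v 1 P i] complex_Re_le_cmod[of "exponent_sum P v i"] assms(2) by simp
  hence "norm (r $ i * exp (exponent_sum P v i)) \<le> trinomial_radius P * exp (weight P)"
    unfolding norm_mult norm_exp_eq_Re using assms(1) trinomial_radius_pos[of P]
    by (intro mult_mono) auto
  also have "\<dots> = 1 / (4 * (weight P + 1))"
    by (simp add: trinomial_radius_def exp_minus)
  also have "\<dots> \<le> 1 / 4" using weight_nonneg[of P] by (simp add: field_simps)
  finally show ?thesis .
qed

text \<open>Comparison with Ln 1 = 0 shows that the unit polydisc is mapped into itself.\<close>

lemma trinomial_map_bounded:
  assumes "norm (r $ i) \<le> trinomial_radius P" "\<And>l. norm (v l) \<le> 1"
  shows "norm (trinomial_map P r v i) \<le> 1"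
proof -
  have small: "norm (r $ i * exp (exponent_sum P v i)) \<le> 1 / 4"
    by (intro trinomial_arg_small assms)
  hence "norm (Ln (1 - r $ i * exp (exponent_sum P v i)) - Ln 1)
      \<le> 2 * norm (1 - r $ i * exp (exponent_sum P v i) - 1)"
    by (intro norm_Ln_diff_le) auto
  thus ?thesis using small by (simp add: trinomial_map_def)
qed

text \<open>The Lipschitz constants of \<open>Ln\<close>, exp and the exponent sum are 2, exp L and
  L, where L = \<open>weight P\<close>; the radius reduces their product to at most 1/2.\<close>

lemma trinomial_map_contraction:
  assumes r: "norm (r $ i) \<le> trinomial_radius P"
    and v: "\<And>l. norm (v l) \<le> 1" "\<And>l. norm (v' l) \<le> 1"
    and D: "\<And>l. norm (v l - v' l) \<le> D"
  shows "norm (trinomial_map P r v i - trinomial_map P r v' i) \<le> D / 2"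
proof -
  let ?s = "exponent_sum P v i" and ?s' = "exponent_sum P v' i" and ?L = "weight P"
  have D0: "D \<ge> 0" using D[of undefined] norm_ge_zero order_trans by blast
  have s: "norm ?s \<le> ?L" "norm ?s' \<le> ?L"
    using norm_exponent_sum_le[of v 1] norm_exponent_sum_le[of v' 1] v by simp_all
  have "norm (trinomial_map P r v i - trinomial_map P r v' i)
      \<le> 2 * norm ((1 - r $ i * exp ?s) - (1 - r $ i * exp ?s'))"
    unfolding trinomial_map_def
    using trinomial_arg_small[where v = v and r = r, OF r v(1)]
      trinomial_arg_small[where v = v' and r = r, OF r v(2)]
    by (intro norm_Ln_diff_le) auto
  also have "(1 - r $ i * exp ?s) - (1 - r $ i * exp ?s') = - (r $ i * (exp ?s - exp ?s'))"
    by (simp add: algebra_simps)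
  also have "norm \<dots> = norm (r $ i) * norm (exp ?s - exp ?s')"
    by (simp add: norm_mult)
  also have "\<dots> \<le> trinomial_radius P * (exp ?L * (?L * D))"
  proof (intro mult_mono r)
    have "norm (exp ?s - exp ?s') \<le> exp ?L * norm (?s - ?s')"
      by (rule norm_exp_diff_le[OF s])
    also have "\<dots> \<le> exp ?L * (?L * D)"
      unfolding exponent_sum_diff by (intro mult_left_mono norm_exponent_sum_le D) auto
    finally show "norm (exp ?s - exp ?s') \<le> exp ?L * (?L * D)" .
  qed (use trinomial_radius_pos[of P] in auto)
  also have "\<dots> = D / 4 * (?L / (?L + 1))"
    by (simp add: trinomial_radius_def exp_minus)
  also have "\<dots> \<le> D / 4 * 1"
    using D0 weight_nonneg[of P] by (intro mult_left_mono) (auto simp: field_simps)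
  finally show ?thesis by simp
qed

lemma exp_trinomial_map:
  assumes "norm (r $ i) \<le> trinomial_radius P" "\<And>l. norm (v l) \<le> 1"
  shows "exp (trinomial_map P r v i) = 1 - r $ i * exp (exponent_sum P v i)"
proof -
  have "r $ i * exp (exponent_sum P v i) \<noteq> 1"
    using trinomial_arg_small[where r = r and v = v, OF assms] by auto
  thus ?thesis unfolding trinomial_map_def by (intro exp_Ln) auto
qed

text \<open>The family is the limit of the iterates from 0. Halving the radius for r keeps t r
  admissible for |t| < 2, so t = 1 is an interior point. Contraction towards the fixed point u
  identifies the value there.\<close>

lemma holomorphic_solution_family:
  fixes P :: "real^'n^'n"
  assumes r: "\<And>i. norm (r $ i) \<le> trinomial_radius P / 2"
    and u: "\<And>i. norm (u i) \<le> 1" "\<And>i. exp (u i) + r $ i * exp (exponent_sum P u i) = 1"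
  obtains v :: "complex \<Rightarrow> 'n \<Rightarrow> complex" where
    "\<And>i. (\<lambda>t. v t i) holomorphic_on ball 0 2" "\<And>i. v 0 i = 0" "\<And>i. v 1 i = u i"
    "\<And>t i. t \<in> ball 0 2 \<Longrightarrow> exp (v t i) + t * r $ i * exp (exponent_sum P (v t) i) = 1"
proof -
  define w where "w m t = (trinomial_map P (t *s r) ^^ m) (\<lambda>_. 0)" for m t
  have w_0: "w 0 t i = 0" for t i by (simp add: w_def)
  have w_Suc: "w (Suc m) t i = trinomial_map P (t *s r) (w m t) i" for m t i by (simp add: w_def)
  have tr: "norm ((t *s r) $ i) \<le> trinomial_radius P" if "t \<in> ball 0 2" for t i
  proof -
    have "norm t * norm (r $ i) \<le> 2 * (trinomial_radius P / 2)"
      using that r[of i] by (intro mult_mono) auto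
    thus ?thesis by (simp add: norm_mult)
  qed
  have bdd: "norm (w m t i) \<le> 1" if t: "t \<in> ball 0 2" for m t i
  proof (induction m arbitrary: i)
    case (Suc m)
    then show ?case unfolding w_Suc by (intro trinomial_map_bounded tr[OF t])
  qed (simp add: w_0)
  have step: "norm (w (Suc m) t i - w m t i) \<le> (1 / 2) ^ m" if t: "t \<in> ball 0 2" for m t i
  proof (induction m arbitrary: i)
    case 0
    show ?case using bdd[OF t, of 1 i] by (simp add: w_0)
  next
    case (Suc m)
    have "norm (trinomial_map P (t *s r) (w (Suc m) t) i - trinomial_map P (t *s r) (w m t) i) \<le> (1 / 2) ^ m / 2"
      by (intro trinomial_map_contraction tr[OF t] bdd[OF t] Suc.IH)
    thus ?case by (simp add: w_Suc)
  qed
  have hol: "(\<lambda>t. w m t i) holomorphic_on ball 0 2" for m i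
  proof (induction m arbitrary: i)
    case (Suc m)
    have "1 - (t * r $ i) * exp (exponent_sum P (w m t) i) \<notin> \<real>\<^sub>\<le>\<^sub>0" if t: "t \<in> ball 0 2" for t
    proof -
      have "norm ((t *s r) $ i * exp (exponent_sum P (w m t) i)) \<le> 1 / 4"
        by (intro trinomial_arg_small tr[OF t] bdd[OF t])
      hence "Re (t * r $ i * exp (exponent_sum P (w m t) i)) \<le> 1 / 4"
        using complex_Re_le_cmod[of "t * r $ i * exp (exponent_sum P (w m t) i)"] by simp
      hence "Re (1 - (t * r $ i) * exp (exponent_sum P (w m t) i)) > 0" by simp
      thus ?thesis by (auto simp: complex_nonpos_Reals_iff)
    qed
    hence "(\<lambda>t. Ln (1 - (t * r $ i) * exp (exponent_sum P (w m t) i))) holomorphic_on ball 0 2"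
      unfolding exponent_sum_def by (intro holomorphic_intros Suc.IH)
    thus ?case by (simp add: w_Suc trinomial_map_def)
  qed (simp add: w_0)
  \<comment> \<open>The telescoping form, with increments at most 2^(-m), makes the convergence
    uniform by the M-test, so the limit is holomorphic.\<close>
  define v where "v t i = (\<Sum>m. w (Suc m) t i - w m t i)" for t i
  have ulim: "uniform_limit (ball 0 2) (\<lambda>n t. w n t i) (\<lambda>t. v t i) sequentially" for i
  proof -
    have "uniform_limit (ball 0 2) (\<lambda>n t. \<Sum>m<n. w (Suc m) t i - w m t i) (\<lambda>t. v t i) sequentially"
      unfolding v_def
      by (rule Weierstrass_m_test[where M = "\<lambda>m. (1 / 2) ^ m"]) (auto intro: step summable_geometric)
    moreover have "(\<Sum>m<n. w (Suc m) t i - w m t i) = w n t i" for n t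
      using sum_lessThan_telescope[of "\<lambda>m. w m t i" n] by (simp add: w_0)
    ultimately show ?thesis by simp
  qed
  have lim: "(\<lambda>n. w n t i) \<longlonglongrightarrow> v t i" if "t \<in> ball 0 2" for t i
    using ulim that by (rule tendsto_uniform_limitI)
  show ?thesis
  proof (rule that[of v])
    fix i
    show "(\<lambda>t. v t i) holomorphic_on ball 0 2"
    proof (rule holomorphic_uniform_sequence[OF _ hol])
      fix x :: complex assume "x \<in> ball 0 2"
      then obtain e where "e > 0" "cball x e \<subseteq> ball 0 2"
        using open_contains_cball[of "ball (0::complex) 2"] open_ball by blast
      thus "\<exists>d>0. cball x d \<subseteq> ball 0 2 \<and> uniform_limit (cball x d) (\<lambda>n t. w n t i) (\<lambda>t. v t i) sequentially"
        using uniform_limit_on_subset[OF ulim] by blast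
    qed simp
    have "w n 0 i = 0" for n
      by (cases n) (simp_all add: w_0 w_Suc trinomial_map_def)
    hence "(\<lambda>n. w n 0 i) \<longlonglongrightarrow> 0" by simp
    with lim[of 0 i] show "v 0 i = 0" using LIMSEQ_unique by auto
    \<comment> \<open>The principal logarithm inverts exp at u_i because |Im u_i| <= 1 < pi.\<close>
    have u_fix: "u i = trinomial_map P (1 *s r) u i" for i
    proof -
      have "trinomial_map P (1 *s r) u i = Ln (exp (u i))"
        using eq_diff_eq[THEN iffD2, OF u(2)[of i]] by (simp add: trinomial_map_def)
      also have "\<dots> = u i"
        using abs_Im_le_cmod[of "u i"] u(1)[of i] pi_gt3 by (intro Ln_exp) auto
      finally show ?thesis by simp
    qed
    have le: "norm (w n 1 i - u i) \<le> (1 / 2) ^ n" for n i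
    proof (induction n arbitrary: i)
      case (Suc n)
      have "norm (trinomial_map P (1 *s r) (w n 1) i - trinomial_map P (1 *s r) u i) \<le> (1 / 2) ^ n / 2"
        by (intro trinomial_map_contraction tr bdd u(1) Suc.IH) auto
      thus ?case using u_fix[of i] by (simp add: w_Suc)
    qed (use u(1) in \<open>simp add: w_0\<close>)
    have "(\<lambda>n. (1 / 2 :: real) ^ n) \<longlonglongrightarrow> 0" by (rule LIMSEQ_power_zero) simp
    hence "(\<lambda>n. w n 1 i - u i) \<longlonglongrightarrow> 0"
      by (rule Lim_null_comparison[OF always_eventually[OF allI[OF le]]])
    hence "(\<lambda>n. w n 1 i) \<longlonglongrightarrow> u i" using Lim_null by blast
    with lim[of 1 i] show "v 1 i = u i" using LIMSEQ_unique by auto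
  next
    fix t i assume t: "t \<in> ball (0::complex) 2"
    have "(\<lambda>n. exp (w (Suc n) t i)) \<longlonglongrightarrow> exp (v t i)"
      by (intro tendsto_intros LIMSEQ_Suc lim t)
    moreover have "exp (w (Suc n) t i) = 1 - t * r $ i * exp (exponent_sum P (w n t) i)" for n
      unfolding w_Suc using exp_trinomial_map[where r = "t *s r" and v = "w n t", OF tr[OF t] bdd[OF t]] by simp
    moreover have "(\<lambda>n. 1 - t * r $ i * exp (exponent_sum P (w n t) i)) \<longlonglongrightarrow>
        1 - t * r $ i * exp (exponent_sum P (v t) i)"
      unfolding exponent_sum_def by (intro tendsto_intros lim t)
    ultimately have "exp (v t i) = 1 - t * r $ i * exp (exponent_sum P (v t) i)"
      using LIMSEQ_unique by auto
    thus "exp (v t i) + t * r $ i * exp (exponent_sum P (v t) i) = 1" by simp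
  qed
qed

section \<open>Comparison of coefficients\<close>

text \<open>Given degree m, the shared recurrence fixes degree m + 1 only up to a function of c with
  period e_l for all l. Polynomial dependence makes that function constant, and the value at c = 0
  makes it zero.\<close>

lemma fps_expansion_exp_sum_eq_good_hom:
  fixes P :: "real^'n^'n" and v :: "complex \<Rightarrow> 'n \<Rightarrow> complex"
  assumes hol: "\<And>i. (\<lambda>t. v t i) holomorphic_on ball 0 R" and R: "R > 0"
    and v0: "\<And>i. v 0 i = 0"
    and sol: "\<And>t i. t \<in> ball 0 R \<Longrightarrow> exp (v t i) + t * r $ i * exp (exponent_sum P (v t) i) = 1"
  shows "fps_nth (fps_expansion (\<lambda>t. exp (\<Sum>l\<in>UNIV. of_real (c $ l) * v t l)) 0) m = good_hom P r m c"
proof -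
  define H where "H c t = exp (\<Sum>l\<in>UNIV. of_real (c $ l) * v t l)" for c :: "real^'n" and t
  define G where "G c = fps_expansion (H c) 0" for c
  define V where "V l = fps_expansion (\<lambda>t. v t l) 0" for l
  have in_ball: "eventually (\<lambda>t. t \<in> ball (0::complex) R) (nhds 0)"
    using R by (intro eventually_nhds_in_open) auto
  have holH: "H c holomorphic_on ball 0 R" for c
    unfolding H_def by (intro holomorphic_intros hol)
  have HG: "H c has_fps_expansion G c" for c
    unfolding G_def using R by (intro has_fps_expansion_fps_expansion[OF _ _ holH]) auto
  have vV: "(\<lambda>t. v t l) has_fps_expansion V l" for l
    unfolding V_def using R by (intro has_fps_expansion_fps_expansion[OF _ _ hol]) auto
  have G0: "fps_nth (G c) 0 = 1" for c
    using has_fps_expansion_imp_0_eq_fps_nth_0[OF HG[of c]] by (simp add: H_def v0)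
  have "(\<lambda>_. 1) has_fps_expansion (1 :: complex fps)" by (rule fps_expansion_intros)
  moreover have "H 0 = (\<lambda>_. 1)" by (simp add: H_def fun_eq_iff)
  ultimately have Gz: "G 0 = 1"
    using HG[of 0] by (auto intro: fps_expansion_unique_complex)
  \<comment> \<open>This is equation l multiplied by e^(c.v): the factors e^(v_l) and e^(s_l), where
    s_l is the exponent sum, shift c by e_l and by column l of P.\<close>
  have rec: "fps_nth (G c) (Suc m) = fps_nth (G (c + axis l 1)) (Suc m) + r $ l * fps_nth (G (c + column l P)) m"
    for c l m
  proof -
    have fps: "(\<lambda>t. H (c + axis l 1) t + r $ l * (t * H (c + column l P) t)) has_fps_expansion
       G (c + axis l 1) + fps_const (r $ l) * (fps_X * G (c + column l P))"
      by (intro fps_expansion_intros HG)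
    have "H c t = H (c + axis l 1) t + r $ l * (t * H (c + column l P) t)" if t: "t \<in> ball 0 R" for t
    proof -
      have "(\<Sum>j\<in>UNIV. complex_of_real (axis l 1 $ j) * v t j) = (\<Sum>j\<in>UNIV. if j = l then v t j else 0)"
        by (intro sum.cong) (auto simp: axis_def)
      hence a: "(\<Sum>j\<in>UNIV. complex_of_real (axis l 1 $ j) * v t j) = v t l" by simp
      have 1: "H (c + axis l 1) t = H c t * exp (v t l)"
        by (simp add: H_def distrib_right sum.distrib exp_add a)
      have 2: "H (c + column l P) t = H c t * exp (exponent_sum P (v t) l)"
        by (simp add: H_def column_def exponent_sum_def distrib_right sum.distrib exp_add)
      have "H c t = H c t * (exp (v t l) + t * r $ l * exp (exponent_sum P (v t) l))"
        by (simp only: sol[OF t] mult_1_right)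
      thus ?thesis unfolding 1 2 by (simp only: ring_distribs mult_ac)
    qed
    hence ev: "eventually (\<lambda>t. H (c + axis l 1) t + r $ l * (t * H (c + column l P) t) = H c t) (nhds 0)"
      by (intro eventually_mono[OF in_ball]) simp
    have "H c has_fps_expansion G (c + axis l 1) + fps_const (r $ l) * (fps_X * G (c + column l P))"
      by (rule iffD1[OF has_fps_expansion_cong[OF ev refl] fps])
    hence "G c = G (c + axis l 1) + fps_const (r $ l) * (fps_X * G (c + column l P))"
      using HG[of c] fps_expansion_unique_complex by blast
    thus ?thesis by simp
  qed
  \<comment> \<open>The logarithmic derivative of e^(c.v) is linear in c. This gives a second
    recurrence for the coefficients, at a fixed c, from which polynomial dependence can be read
    off.\<close>
  have deriv_G: "fps_deriv (G c) = (\<Sum>l\<in>UNIV. fps_const (of_real (c $ l)) * fps_deriv (V l)) * G c" for c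
  proof -
    have fps: "(\<lambda>t. (\<Sum>l\<in>UNIV. of_real (c $ l) * deriv (\<lambda>t. v t l) t) * H c t) has_fps_expansion
       (\<Sum>l\<in>UNIV. fps_const (of_real (c $ l)) * fps_deriv (V l)) * G c"
      by (intro fps_expansion_intros HG vV)
    have "(\<Sum>l\<in>UNIV. of_real (c $ l) * deriv (\<lambda>t. v t l) t) * H c t = deriv (H c) t"
      if t: "t \<in> ball 0 R" for t
    proof -
      have "((\<lambda>t. v t l) has_field_derivative deriv (\<lambda>t. v t l) t) (at t)" for l
        using holomorphic_derivI[OF hol _ t] by simp
      hence "(H c has_field_derivative H c t * (\<Sum>l\<in>UNIV. of_real (c $ l) * deriv (\<lambda>t. v t l) t)) (at t)"
        unfolding H_def by (auto intro!: derivative_eq_intros simp: mult.commute)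
      thus ?thesis by (simp add: DERIV_imp_deriv mult.commute)
    qed
    hence ev: "eventually (\<lambda>t. (\<Sum>l\<in>UNIV. of_real (c $ l) * deriv (\<lambda>t. v t l) t) * H c t = deriv (H c) t) (nhds 0)"
      by (intro eventually_mono[OF in_ball]) simp
    have "deriv (H c) has_fps_expansion
       (\<Sum>l\<in>UNIV. fps_const (of_real (c $ l)) * fps_deriv (V l)) * G c"
      by (rule iffD1[OF has_fps_expansion_cong[OF ev refl] fps])
    thus ?thesis using has_fps_expansion_deriv[OF HG[of c]] fps_expansion_unique_complex by blast
  qed
  have polyG: "polynomial_in (\<lambda>s. fps_nth (G (c + s *\<^sub>R axis l 1)) m)" for c l m
  proof (induction m rule: less_induct)
    case (less m)
    show ?case
    proof (cases m)
      case 0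
      then show ?thesis using polynomial_in_const[of 1] by (simp add: G0)
    next
      case (Suc n)
      \<comment> \<open>Only coefficients of degree at most n = m - 1 occur on the right, so strong
        induction applies along the coordinate line.\<close>
      have *: "fps_nth (G c) m = 1 / of_nat m * (\<Sum>i=0..n. (\<Sum>l\<in>UNIV. of_real (c $ l) * fps_nth (fps_deriv (V l)) i) * fps_nth (G c) (n - i))"
        for c
      proof -
        have "of_nat m * fps_nth (G c) m = fps_nth (fps_deriv (G c)) n"
          by (simp add: Suc)
        also have "\<dots> = (\<Sum>i=0..n. (\<Sum>l\<in>UNIV. of_real (c $ l) * fps_nth (fps_deriv (V l)) i) * fps_nth (G c) (n - i))"
          unfolding deriv_G by (subst fps_mult_nth) (simp add: fps_sum_nth)
        finally show ?thesis using Suc by (simp add: field_simps del: of_nat_Suc)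
      qed
      have c: "polynomial_in (\<lambda>s. of_real ((c + s *\<^sub>R axis l 1) $ j))" for j
        by (auto intro!: polynomial_in_intros)
      show ?thesis
        unfolding * by (intro polynomial_in_intros c less.IH) (use Suc in auto)
    qed
  qed
  have "fps_nth (G c) m = good_hom P r m c"
  proof (induction m arbitrary: c)
    case 0
    show ?case by (simp add: G0)
  next
    case (Suc m)
    define D where "D c = fps_nth (G c) (Suc m) - good_hom P r (Suc m) c" for c
    \<comment> \<open>The terms of degree m, taken at c + column l of P, agree by the induction
      hypothesis and cancel; hence c is arbitrary in the induction.\<close>
    have per: "D (c + axis l 1) = D c" for c l
      unfolding D_def using rec[of c m l] good_hom_rec[of P r m c l] Suc.IH by simp
    have "D (c + s *\<^sub>R axis l 1) = D c" for c l s
    proof -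
      have "polynomial_in (\<lambda>s. D (c + s *\<^sub>R axis l 1))"
        unfolding D_def by (intro polynomial_in_intros polyG polynomial_in_good_hom)
      moreover have "D (c + (s + 1) *\<^sub>R axis l 1) = D (c + s *\<^sub>R axis l 1)" for s
        using per[of "c + s *\<^sub>R axis l 1" l] by (simp add: scaleR_add_left add_ac)
      ultimately have "D (c + s *\<^sub>R axis l 1) = D (c + 0 *\<^sub>R axis l 1)"
        by (rule polynomial_in_periodic_imp_const)
      thus ?thesis by simp
    qed
    hence "D c = D 0" by (rule const_along_axes_imp_const)
    also have "D 0 = 0" by (simp add: D_def Gz good_hom_zero)
    finally show ?case by (simp add: D_def)
  qed
  thus ?thesis by (simp add: G_def H_def[abs_def])
qed

text \<open>The Taylor series of e^(c.v(t)) converges on |t| < 2. At t = 1 it is the series of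
  homogeneous parts, which is then turned into an unconditional sum over multi-indices.\<close>

lemma good_series_eq_exp:
  fixes P :: "real^'n^'n"
  obtains \<epsilon> where "\<epsilon> > 0" and
    "\<And>c r u. (\<And>i. norm (r $ i) \<le> \<epsilon>) \<Longrightarrow> (\<And>i. norm (u i) \<le> 1) \<Longrightarrow>
        (\<And>i. exp (u i) + r $ i * exp (exponent_sum P u i) = 1) \<Longrightarrow>
       ((\<lambda>k. of_real (good_coeff P c k) * monomial r k) has_sum exp (\<Sum>l\<in>UNIV. of_real (c $ l) * u l)) UNIV"
proof -
  obtain \<epsilon> where \<epsilon>: "\<epsilon> > 0" and S: "\<And>c r S. (\<And>j. norm (r $ j) \<le> \<epsilon>) \<Longrightarrow> (\<lambda>m. good_hom P r m c) sums S \<Longrightarrow>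
       ((\<lambda>k. of_real (good_coeff P c k) * monomial r k) has_sum S) UNIV"
    by (rule good_series_has_sum[of P]) blast
  show ?thesis
  proof (rule that[of "min \<epsilon> (trinomial_radius P / 2)"])
    show "min \<epsilon> (trinomial_radius P / 2) > 0" using \<epsilon> trinomial_radius_pos[of P] by simp
    fix c :: "real^'n" and r :: "complex^'n" and u
    assume r: "\<And>i. norm (r $ i) \<le> min \<epsilon> (trinomial_radius P / 2)"
      and u: "\<And>i. norm (u i) \<le> 1" "\<And>i. exp (u i) + r $ i * exp (exponent_sum P u i) = 1"
    have r2: "norm (r $ i) \<le> trinomial_radius P / 2" for i using r[of i] by simp
    obtain v :: "complex \<Rightarrow> 'n \<Rightarrow> complex" where v:
      "\<And>i. (\<lambda>t. v t i) holomorphic_on ball 0 2" "\<And>i. v 0 i = 0" "\<And>i. v 1 i = u i"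
      "\<And>t i. t \<in> ball 0 2 \<Longrightarrow> exp (v t i) + t * r $ i * exp (exponent_sum P (v t) i) = 1"
      by (rule holomorphic_solution_family[OF r2 u]) blast
    define H where "H t = exp (\<Sum>l\<in>UNIV. of_real (c $ l) * v t l)" for t
    have "H holomorphic_on ball 0 2"
      unfolding H_def by (intro holomorphic_intros v)
    from holomorphic_power_series[OF this, of 1]
    have "(\<lambda>m. (deriv ^^ m) H 0 / fact m) sums H 1" by simp
    moreover have "(deriv ^^ m) H 0 / fact m = good_hom P r m c" for m
      using fps_expansion_exp_sum_eq_good_hom[OF v(1) _ v(2) v(4), of c m]
      unfolding H_def by (simp add: fps_expansion_def)
    ultimately have "(\<lambda>m. good_hom P r m c) sums exp (\<Sum>l\<in>UNIV. of_real (c $ l) * u l)"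
      by (simp add: H_def v(3))
    thus "((\<lambda>k. of_real (good_coeff P c k) * monomial r k) has_sum exp (\<Sum>l\<in>UNIV. of_real (c $ l) * u l)) UNIV"
      by (intro S) (use r in auto)
  qed
qed

section \<open>The trinomial system\<close>

lemma matrix_inv_right:
  fixes K :: "real^'n^'n"
  assumes "det K \<noteq> 0"
  shows "K ** matrix_inv K = mat 1"
proof -
  have "\<exists>A. K ** A = mat 1 \<and> A ** K = mat 1"
    using assms invertible_det_nz[of K] by (auto simp: invertible_def)
  thus ?thesis unfolding matrix_inv_def by (rule someI2_ex) simp
qed

text \<open>The adjoint identity x . (K^T w) = (K x) . w, used to pass between the variables u and
  the logarithms of the y_j.\<close>

lemma sum_mult_transpose_vec:
  fixes K :: "real^'n^'n" and w :: "'n \<Rightarrow> complex"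
  shows "(\<Sum>l\<in>UNIV. of_real (x $ l) * (\<Sum>j\<in>UNIV. of_real (K $ j $ l) * w j)) =
         (\<Sum>j\<in>UNIV. of_real ((K *v x) $ j) * w j)"
proof -
  have "(\<Sum>l\<in>UNIV. of_real (x $ l) * (\<Sum>j\<in>UNIV. of_real (K $ j $ l) * w j)) =
        (\<Sum>l\<in>UNIV. \<Sum>j\<in>UNIV. of_real (K $ j $ l * x $ l) * w j)"
    by (simp add: sum_distrib_left mult_ac)
  also have "\<dots> = (\<Sum>j\<in>UNIV. \<Sum>l\<in>UNIV. of_real (K $ j $ l * x $ l) * w j)"
    by (rule sum.swap)
  finally show ?thesis
    by (simp add: matrix_vector_mult_def sum_distrib_right)
qed

lemma monomial_exp:
  assumes "\<And>j. y $ j = exp (w j)"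
  shows "monomial y \<alpha> = exp (\<Sum>j\<in>UNIV. of_nat (\<alpha> $ j) * w j)"
  by (simp add: monomial_def assms exp_sum exp_of_nat_mult)

text \<open>Continuity and y(0) = I put the logarithmic variables in the unit polydisc near r = 0,
  where \<open>good_series_eq_exp\<close> applies. The vector d enters through c with K c =
  d.\<close>

theorem theorem1:
  fixes \<mu> \<nu> \<beta> :: "'n::finite \<Rightarrow> nat^'n"
    and d :: "real^'n"
    and y :: "complex^'n \<Rightarrow> complex^'n"
    and U :: "(complex^'n) set"
  assumes three: "\<And>i. card {\<mu> i, \<nu> i, \<beta> i} = 3"
    and zero_in: "\<And>i. 0 \<in> {\<mu> i, \<nu> i, \<beta> i}"
    and nondeg: "det (kappa_mat \<mu> \<nu>) \<noteq> 0"
    and d_pos: "\<And>j. d $ j > 0"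
    and U_open: "open U" and zero_U: "0 \<in> U"
    and y_cont: "continuous_on U y"
    and y_zero: "y 0 = (\<chi> j. 1)"
    and y_sol: "\<And>r i. r \<in> U \<Longrightarrow>
        r $ i * monomial (y r) (\<beta> i) + monomial (y r) (\<mu> i) - monomial (y r) (\<nu> i) = 0"
  shows "\<exists>e>0. ball 0 e \<subseteq> U \<and>
           (\<forall>r\<in>ball 0 e.
              ((\<lambda>k. complex_of_real (coeff (kappa_mat \<mu> \<nu>) (kappa_mat \<beta> \<nu>) d k) * monomial r k)
                 has_sum real_power_vec (y r) d) UNIV)"
proof -
  define K where "K = kappa_mat \<mu> \<nu>"
  define B where "B = kappa_mat \<beta> \<nu>"
  define P where "P = matrix_inv K ** B"
  define c where "c = matrix_inv K *v d"
  have KP: "K ** P = B" and Kc: "K *v c = d"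
    using matrix_inv_right[of K] nondeg
    by (simp_all add: P_def c_def K_def matrix_mul_assoc matrix_vector_mul_assoc)
  \<comment> \<open>A logarithm of y^(mu_i - nu_i), built from the principal logarithms of the y_j
    and hence tending to 0 with r.\<close>
  define u where "u r i = (\<Sum>j\<in>UNIV. of_real (K $ j $ i) * Ln (y r $ j))" for r i
  obtain \<epsilon> where \<epsilon>: "\<epsilon> > 0" and series:
    "\<And>c r u. (\<And>i. norm (r $ i) \<le> \<epsilon>) \<Longrightarrow> (\<And>i. norm (u i) \<le> 1) \<Longrightarrow>
        (\<And>i. exp (u i) + r $ i * exp (exponent_sum P u i) = 1) \<Longrightarrow>
       ((\<lambda>k. of_real (good_coeff P c k) * monomial r k) has_sum exp (\<Sum>l\<in>UNIV. of_real (c $ l) * u l)) UNIV"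
    by (rule good_series_eq_exp[of P]) blast
  have "isCont y 0"
    using y_cont U_open zero_U continuous_on_eq_continuous_at by blast
  hence lim_y: "(y \<longlongrightarrow> y 0) (nhds 0)"
    by (simp add: isCont_def tendsto_at_iff_tendsto_nhds)
  have lim_yj: "((\<lambda>r. y r $ j) \<longlongrightarrow> 1) (nhds 0)" for j
    using tendsto_vec_nth[OF lim_y, of j] by (simp add: y_zero)
  have "((\<lambda>r. u r i) \<longlongrightarrow> (\<Sum>j\<in>UNIV. of_real (K $ j $ i) * Ln 1)) (nhds 0)" for i
    unfolding u_def by (intro tendsto_intros lim_yj) auto
  hence lim_u: "((\<lambda>r. norm (u r i)) \<longlongrightarrow> 0) (nhds 0)" for i
    using tendsto_norm_zero by fastforce
  have "eventually (\<lambda>r. \<forall>i. norm (u r i) < 1) (nhds 0)"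
    by (intro eventually_all_finite order_tendstoD(2)[OF lim_u]) auto
  moreover have "eventually (\<lambda>r. \<forall>j. y r $ j \<noteq> 0) (nhds 0)"
    by (intro eventually_all_finite tendsto_imp_eventually_ne[OF lim_yj]) auto
  moreover have "eventually (\<lambda>r. r \<in> U) (nhds 0)"
    using U_open zero_U by (rule eventually_nhds_in_open)
  moreover have "eventually (\<lambda>r. r \<in> ball 0 \<epsilon>) (nhds (0 :: complex^'n))"
    using \<epsilon> by (intro eventually_nhds_in_open) auto
  ultimately have "eventually (\<lambda>r. (\<forall>i. norm (u r i) < 1) \<and> (\<forall>j. y r $ j \<noteq> 0) \<and> r \<in> U \<and> r \<in> ball 0 \<epsilon>) (nhds 0)"
    by eventually_elim blast
  then obtain e where e: "e > 0" and near: "\<And>r. r \<in> ball 0 e \<Longrightarrow>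
      (\<forall>i. norm (u r i) < 1) \<and> (\<forall>j. y r $ j \<noteq> 0) \<and> r \<in> U \<and> r \<in> ball 0 \<epsilon>"
    unfolding eventually_nhds_metric by (auto simp: dist_commute)
  have "((\<lambda>k. of_real (coeff K B d k) * monomial r k) has_sum real_power_vec (y r) d) UNIV"
    if r: "r \<in> ball 0 e" for r
  proof -
    define w where "w j = Ln (y r $ j)" for j
    have yw: "y r $ j = exp (w j)" for j
      using near[OF r] by (simp add: w_def)
    have K_sum: "(\<Sum>l\<in>UNIV. of_real (x $ l) * u r l) = (\<Sum>j\<in>UNIV. of_real ((K *v x) $ j) * w j)" for x
      unfolding u_def w_def by (rule sum_mult_transpose_vec)
    \<comment> \<open>Since d = K c, the exponent d . w equals c . u by the adjoint
      identity.\<close>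
    have pow: "real_power_vec (y r) d = exp (\<Sum>l\<in>UNIV. of_real (c $ l) * u r l)"
      unfolding K_sum Kc real_power_vec_def using near[OF r]
      by (simp add: powr_def exp_sum w_def)
    have sol: "exp (u r i) + r $ i * exp (exponent_sum P (u r) i) = 1" for i
    proof -
      let ?m = "\<lambda>\<alpha>. \<Sum>j\<in>UNIV. of_nat (\<alpha> i $ j) * w j"
      have u_eq: "u r i = ?m \<mu> - ?m \<nu>"
        by (simp add: u_def w_def K_def kappa_mat_def sum_subtractf left_diff_distrib)
      have "K *v column i P = column i B"
        unfolding KP[symmetric] by (simp add: vec_eq_iff column_def matrix_vector_mult_def matrix_matrix_mult_def)
      hence "exponent_sum P (u r) i = (\<Sum>j\<in>UNIV. of_real (B $ j $ i) * w j)"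
        using K_sum[of "column i P"] by (simp add: exponent_sum_def column_def)
      also have "\<dots> = ?m \<beta> - ?m \<nu>"
        by (simp add: B_def kappa_mat_def sum_subtractf left_diff_distrib)
      finally have s_eq: "exponent_sum P (u r) i = ?m \<beta> - ?m \<nu>" .
      \<comment> \<open>Dividing this by the nonzero y^(nu_i) produces the exponents s_i and u_i of
        the logarithmic system.\<close>
      have "r $ i * exp (?m \<beta>) + exp (?m \<mu>) - exp (?m \<nu>) = 0"
        using y_sol[of r i] near[OF r] by (simp add: monomial_exp[where w = w, OF yw])
      thus ?thesis
        unfolding u_eq s_eq exp_diff by (simp add: field_simps)
    qed
    have "norm (r $ i) \<le> \<epsilon>" for i
      using near[OF r] Finite_Cartesian_Product.norm_nth_le[of r i] by simp
    moreover have "norm (u r i) \<le> 1" for i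
      using near[OF r] less_imp_le by blast
    ultimately show ?thesis
      unfolding coeff_eq_good_coeff pow using series[of r "u r" c] sol
      by (simp add: P_def c_def)
  qed
  moreover have "ball 0 e \<subseteq> U" using near by blast
  ultimately show ?thesis using e by (auto simp: K_def B_def)
qed

end
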